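(* Let $p\in\mathcal{H}_1$ and let $\beta$ be a real number. Then each of the following conditions is sufficient for $p(z)\prec e^z$: (a) $p(z)+\beta zp'(z)\prec \dfrac{2+2z}{2-z}$, where $\beta\ge\dfrac{e+2-\sqrt2(e-1)}{e(\sqrt2-1)}$ $(\approx 2.0323)$; (b) $p(z)+\beta\dfrac{zp'(z)}{p(z)}\prec \dfrac{2+2z}{2-z}$, where $\beta\ge\dfrac{e+2-\sqrt2(e-1)}{\sqrt2-1}$ $(\approx 5.52436)$.
   Context: $\mathbb{D}=\{z\in\mathbb{C}:|z|<1\}$. $\mathcal{H}_1$ is the class of analytic functions on $\mathbb{D}$ of the form $p(z)=1+a_1z+a_2z^2+\cdots$. For functions $F,G$ analytic in $\mathbb{D}$, $F\prec G$ (F is subordinate to G) means there is an analytic $w:\mathbb{D}\to\mathbb{C}$ with $w(0)=0$, $|w(z)|<1$ and $F(z)=G(w(z))$ for all $z\in\mathbb{D}$; writing $F\prec G$ presupposes that $F$ and $G$ are analytic in $\mathbb{D}$. *)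

theory Defs
  imports "HOL-Complex_Analysis.Complex_Analysis"
begin

abbreviation unit_disk :: "complex set" where
  "unit_disk \<equiv> ball 0 1"

definition H1 :: "(complex \<Rightarrow> complex) set" where
  "H1 = {p. p holomorphic_on unit_disk \<and>
            (\<exists>a. a 0 = 1 \<and> (\<forall>z\<in>unit_disk. (\<lambda>n. a n * z ^ n) sums p z))}"

text \<open>
  Analyticity of \<open>F\<close> and \<open>G\<close> is part of subordination. In particular, for \<open>p \<in> H1\<close> and
  \<open>\<beta> \<noteq> 0\<close>, a function \<open>\<lambda>z. p z + \<beta> * (z * deriv p z / p z)\<close> that is subordinate to
  something forces \<open>p\<close> to have no zero in the disk: near a zero of \<open>p\<close> it is unbounded,
  whatever value division by zero assigns at the zero itself.
\<close>
definition subordinate :: "(complex \<Rightarrow> complex) \<Rightarrow> (complex \<Rightarrow> complex) \<Rightarrow> bool" where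
  "subordinate F G \<longleftrightarrow>
     F holomorphic_on unit_disk \<and> G holomorphic_on unit_disk \<and>
     (\<exists>w. w holomorphic_on unit_disk \<and> w 0 = 0 \<and>
          (\<forall>z\<in>unit_disk. norm (w z) < 1 \<and> F z = G (w z)))"

end

theory Submission
  imports Defs
begin

text \<open>
  The map \<open>z \<mapsto> (2 + 2 * z) / (2 - z)\<close> takes the unit disk into the disk of centre and radius 2.
  If \<open>p\<close> is not subordinate to \<open>exp\<close>, let \<open>z\<close> be a point of least modulus at which \<open>p\<close>
  leaves the image of the unit disk under \<open>exp\<close>, and let \<open>g = Ln \<circ> p\<close>. Then
  \<open>w = g z\<close> has modulus 1, and Jack's lemma gives \<open>z * g' z = k * w\<close> for some \<open>k \<ge> 1\<close>, so
  the two differential expressions take the values \<open>exp w * (1 + \<beta> * k * w)\<close> and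
  \<open>exp w + \<beta> * k * w\<close> at \<open>z\<close>. For the given \<open>\<beta>\<close> both values are at distance at least 2 from 2.
\<close>

section \<open>Jack's lemma\<close>

text \<open>Restricting to the line through \<open>z\<close> in direction \<open>u\<close> makes
  one-variable monotonicity criteria such as \<open>DERIV_pos_inc_right\<close> available for a
  rotated real part.\<close>

lemma has_real_derivative_Re_line:
  assumes "(f has_field_derivative m) (at z)"
  shows "((\<lambda>t. Re (a * f (z + of_real t * u))) has_real_derivative Re (a * m * u)) (at 0)"
proof -
  have "((\<lambda>t. z + of_real t * u) has_vector_derivative u) (at 0)"
    by (auto intro!: derivative_eq_intros has_vector_derivative_real_field)
  then have "((\<lambda>t. f (z + of_real t * u)) has_vector_derivative u * m) (at 0)"
    using field_vector_diff_chain_at[of "\<lambda>t. z + of_real t * u" u 0 f m] assms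
    by (simp add: o_def)
  then have "((\<lambda>t. a * f (z + of_real t * u)) has_vector_derivative a * (u * m)) (at 0)"
    by (auto intro!: derivative_eq_intros)
  then have "((\<lambda>t. Re (a * f (z + of_real t * u))) has_vector_derivative Re (a * (u * m))) (at 0)"
    by (rule bounded_linear.has_vector_derivative[OF bounded_linear_Re])
  then show ?thesis
    by (simp add: has_real_derivative_iff_has_vector_derivative mult_ac)
qed

text \<open>Rotate by \<open>a = cnj (f 1)\<close>, so that \<open>a * f 1 = 1\<close>. If
  \<open>a * m\<close> were not real, some direction into the disk would push
  \<open>Re (a * f)\<close> above 1. That \<open>Re (a * m)\<close> is at least 1 follows from the
  Schwarz lemma along the radius ending at 1.\<close>

lemma Jack_unit:
  assumes hol: "f holomorphic_on ball 0 1" and f0: "f 0 = 0"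
    and less: "\<And>z. norm z < 1 \<Longrightarrow> norm (f z) < 1"
    and der: "(f has_field_derivative m) (at 1)" and f1: "norm (f 1) = 1"
  obtains k where "k \<ge> 1" "m = of_real k * f 1"
proof -
  define a where "a = cnj (f 1)"
  have af1: "a * f 1 = 1"
    using complex_norm_square[of "f 1"] f1 by (simp add: a_def mult.commute)
  have na: "norm a = 1" using f1 by (simp add: a_def)
  have Re_le: "Re (a * f z) \<le> norm (f z)" for z
    using complex_Re_le_cmod[of "a * f z"] by (simp add: norm_mult na)
  have Im0: "Im (a * m) = 0"
  proof (rule ccontr)
    assume ne: "Im (a * m) \<noteq> 0"
    \<comment> \<open>\<open>y\<close> is chosen so that the inward direction
      \<open>u = -1 - i*y\<close> gives \<open>Re (a * f)\<close> slope exactly 1.\<close>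
    define y where "y = (Re (a * m) + 1) / Im (a * m)"
    define u where "u = Complex (-1) (- y)"
    have "Re (a * m * u) = Im (a * m) * y - Re (a * m)"
      by (simp add: u_def algebra_simps)
    then have "Re (a * m * u) = 1"
      using ne by (simp add: y_def)
    then obtain d where d: "d > 0"
      and inc: "\<And>h. 0 < h \<Longrightarrow> h < d \<Longrightarrow> Re (a * f 1) < Re (a * f (1 + of_real h * u))"
      using DERIV_pos_inc_right[OF has_real_derivative_Re_line[OF der, of a u]] by auto
    \<comment> \<open>The second bound on \<open>h\<close> gives \<open>h * (1 + y^2) <= 1\<close>,
      so the squared norm of \<open>1 + h * u\<close> is at most \<open>1 - h\<close> and the point
      lies in the open disk.\<close>
    define h where "h = min (d / 2) (1 / (1 + y\<^sup>2))"
    have pos: "1 + y\<^sup>2 > 0" by (simp add: add_pos_nonneg)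
    have h: "0 < h" "h < d" using d pos by (auto simp: h_def min_def)
    have "h * (1 + y\<^sup>2) \<le> 1"
      using pos by (simp add: h_def min_def field_simps)
    then have "h * (h * (1 + y\<^sup>2)) \<le> h * 1"
      using h(1) by (intro mult_left_mono) auto
    moreover have "(norm (1 + of_real h * u))\<^sup>2 = 1 - 2 * h + h * (h * (1 + y\<^sup>2))"
      unfolding cmod_power2 by (simp add: u_def power2_eq_square algebra_simps)
    ultimately have "(norm (1 + of_real h * u))\<^sup>2 < 1\<^sup>2" using h(1) by simp
    then have "norm (1 + of_real h * u) < 1"
      by (rule power2_less_imp_less) simp
    from less[OF this] Re_le[of "1 + of_real h * u"] inc[OF h] show False
      by (simp add: af1)
  qed
  have Re1: "Re (a * m) \<ge> 1"
  proof (rule ccontr)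
    assume "\<not> ?thesis"
    then have pos: "Re (a * m * (-1)) + 1 > 0" by simp
    \<comment> \<open>The added \<open>t\<close> encodes the comparison with \<open>1 - t\<close>:
      an increase of this sum means that \<open>Re (a * f (1 - h))\<close> exceeds
      \<open>1 - h\<close>, the Schwarz bound.\<close>
    have "((\<lambda>t. Re (a * f (1 + of_real t * (-1))) + t) has_real_derivative
            Re (a * m * (-1)) + 1) (at 0)"
      by (rule DERIV_add[OF has_real_derivative_Re_line[OF der] DERIV_ident])
    from DERIV_pos_inc_right[OF this pos] obtain d where d: "d > 0"
      and inc: "\<And>h. 0 < h \<Longrightarrow> h < d \<Longrightarrow> 1 < Re (a * f (1 - of_real h)) + h"
      by (auto simp: af1)
    define h where "h = min (d / 2) (1 / 2)"
    have h: "0 < h" "h < d" "h < 1" using d by (auto simp: h_def min_def)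
    have n: "norm (1 - of_real h :: complex) = 1 - h"
      using h by (metis abs_of_pos diff_gt_0_iff_gt norm_of_real of_real_1 of_real_diff)
    have "norm (f (1 - of_real h)) \<le> 1 - h"
      using Schwarz_Lemma(1)[OF hol f0 less, of "1 - of_real h"] n h by simp
    with inc[OF h(1,2)] Re_le[of "1 - of_real h"] show False by simp
  qed
  have "m = f 1 * (a * m)"
    using af1 by (metis mult.commute mult.left_commute mult.right_neutral)
  also have "a * m = of_real (Re (a * m))"
    using Im0 by (simp add: complex_eq_iff)
  finally show ?thesis using that[OF Re1] by (simp add: mult.commute)
qed

lemma Jack:
  assumes hol: "g holomorphic_on ball 0 (norm z0)" and g0: "g 0 = 0"
    and less: "\<And>z. norm z < norm z0 \<Longrightarrow> norm (g z) < 1"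
    and der: "(g has_field_derivative d) (at z0)" and g1: "norm (g z0) = 1"
  obtains k where "k \<ge> 1" "z0 * d = of_real k * g z0"
proof -
  have "z0 \<noteq> 0" using g0 g1 by auto
  have *: "norm (z0 * z) < norm z0" if "norm z < 1" for z
    using that \<open>z0 \<noteq> 0\<close> by (simp add: norm_mult)
  have "(g \<circ> (\<lambda>z. z0 * z)) holomorphic_on ball 0 1"
    by (rule holomorphic_on_compose_gen[OF _ hol]) (auto intro!: holomorphic_intros *)
  moreover have "((\<lambda>z. g (z0 * z)) has_field_derivative d * z0) (at 1)"
    by (rule DERIV_chain2[of g d "\<lambda>z. z0 * z" 1 z0]) (use der in \<open>auto intro!: derivative_eq_intros\<close>)
  ultimately show ?thesis
    using Jack_unit[of "\<lambda>z. g (z0 * z)" "d * z0"] g0 g1 less * that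
    by (auto simp: o_def mult.commute)
qed

section \<open>Leaving the image of the unit disk under the exponential\<close>

text \<open>Since 1 < pi/2, the closed disk lies in a strip on which \<open>exp\<close> has positive
  real part. The boundary is included because the exit point has \<open>norm w = 1\<close>.\<close>

lemma Ln_exp_cball:
  assumes "norm w \<le> 1"
  shows "Ln (exp w) = w" "exp w \<notin> \<real>\<^sub>\<le>\<^sub>0"
proof -
  have "\<bar>Im w\<bar> \<le> 1" using abs_Im_le_cmod[of w] assms by linarith
  then have "- (pi/2) < Im w" "Im w < pi/2" using pi_gt3 by auto
  then show "exp w \<notin> \<real>\<^sub>\<le>\<^sub>0"
    using cos_gt_zero_pi[of "Im w"] by (auto simp: complex_nonpos_Reals_iff Re_exp mult_le_0_iff not_le)
  show "Ln (exp w) = w"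
    using \<open>- (pi/2) < Im w\<close> \<open>Im w < pi/2\<close> by (intro Ln_exp) auto
qed

text \<open>The Schwarz function is \<open>Ln\<close> composed with \<open>p\<close>.\<close>

lemma subordinate_expI:
  assumes hol: "p holomorphic_on ball 0 1" and p0: "p 0 = 1"
    and img: "\<And>z. norm z < 1 \<Longrightarrow> p z \<in> exp ` ball 0 1"
  shows "subordinate p exp"
  unfolding subordinate_def
proof (intro conjI exI ballI)
  show "p holomorphic_on ball 0 1" by fact
  show "exp holomorphic_on ball 0 1" by (intro holomorphic_intros)
  have "p z \<notin> \<real>\<^sub>\<le>\<^sub>0" if "norm z < 1" for z
    using img[OF that] Ln_exp_cball(2) by auto
  then show "(\<lambda>z. Ln (p z)) holomorphic_on ball 0 1"
    by (intro holomorphic_intros hol) auto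
  show "Ln (p 0) = 0" by (simp add: p0)
  fix z :: complex assume "z \<in> ball 0 1"
  then obtain w where w: "norm w < 1" "p z = exp w" using img[of z] by auto
  then show "norm (Ln (p z)) < 1" "p z = exp (Ln (p z))"
    using Ln_exp_cball(1)[of w] by auto
qed

lemma exp_image_exit_point:
  assumes hol: "p holomorphic_on ball 0 1" and p0: "p 0 = 1" and nsub: "\<not> subordinate p exp"
  obtains z w k where "norm z < 1" "norm w = 1" "k \<ge> 1" "p z = exp w"
    "z * deriv p z = of_real k * w * exp w"
proof -
  let ?E = "exp ` ball (0::complex) 1"
  obtain z1 where z1: "norm z1 < 1" "p z1 \<notin> ?E"
    using subordinate_expI[OF hol p0] nsub by blast
  have openE: "open ?E"
  proof (rule open_mapping_thm3)
    show "inj_on exp (ball (0::complex) 1)"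
      by (rule inj_on_inverseI[of _ Ln]) (simp add: Ln_exp_cball(1))
  qed (auto intro!: holomorphic_intros)
  let ?K = "cball 0 (norm z1)"
  \<comment> \<open>Points of the closed disk through \<open>z1\<close> where \<open>p\<close> is
    outside \<open>?E\<close>. As \<open>?E\<close> is open, this set is compact, so the least
    modulus is attained.\<close>
  let ?S = "?K \<inter> p -` (- ?E)"
  have "continuous_on ?K p"
    using z1(1) by (intro holomorphic_on_imp_continuous_on holomorphic_on_subset[OF hol]) auto
  then have "closed ?S"
    using openE by (intro continuous_closed_preimage) auto
  then have "compact ?S"
    by (rule compact_Int_closed[OF compact_cball[of 0 "norm z1"], of ?S, simplified Int_left_absorb])
  moreover have "?S \<noteq> {}" using z1(2) by auto
  ultimately obtain z0 where z0: "z0 \<in> ?S" and min: "\<And>z. z \<in> ?S \<Longrightarrow> norm z0 \<le> norm z"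
    using continuous_attains_inf[of ?S norm] continuous_on_norm_id by blast
  have nz0: "norm z0 < 1" using z0 z1(1) by auto
  have inE: "p z \<in> ?E" if "norm z < norm z0" for z
    using min[of z] that z0 by force
  have "1 \<in> ?E" by (rule image_eqI[of _ _ 0]) auto
  then have "z0 \<noteq> 0" using z0 p0 by auto
  have "continuous_on (cball 0 (norm z0)) p"
    using nz0 by (intro holomorphic_on_imp_continuous_on holomorphic_on_subset[OF hol]) auto
  \<comment> \<open>By continuity \<open>p z0\<close> lies in the closed image of the closed disk;
    as it is not in \<open>?E\<close>, its preimage \<open>w\<close> there must have modulus
    1.\<close>
  then have "p ` closure (ball 0 (norm z0)) \<subseteq> exp ` cball 0 1"
  proof (intro image_closure_subset)
    show "closed (exp ` cball (0::complex) 1)"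
      by (intro compact_imp_closed compact_continuous_image continuous_intros compact_cball)
    show "p ` ball 0 (norm z0) \<subseteq> exp ` cball 0 1"
      using inE by fastforce
  qed (use \<open>z0 \<noteq> 0\<close> in auto)
  then obtain w where w: "norm w \<le> 1" "p z0 = exp w"
    using \<open>z0 \<noteq> 0\<close> by (force simp: closure_ball)
  have nw: "norm w = 1"
    using w z0 by (force simp: not_less)
  have nonpos: "p z \<notin> \<real>\<^sub>\<le>\<^sub>0" if "norm z < norm z0" for z
    using inE[OF that] Ln_exp_cball(2) by auto
  have dp: "(p has_field_derivative deriv p z0) (at z0)"
    using nz0 by (intro holomorphic_derivI[OF hol]) auto
  have hg: "(\<lambda>z. Ln (p z)) holomorphic_on ball 0 (norm z0)"
    using nz0 nonpos by (intro holomorphic_intros holomorphic_on_subset[OF hol]) auto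
  have g0: "Ln (p 0) = 0" by (simp add: p0)
  have g_less: "norm (Ln (p z)) < 1" if z: "norm z < norm z0" for z
  proof -
    obtain v where "norm v < 1" "p z = exp v" using inE[OF z] by auto
    then show ?thesis using Ln_exp_cball(1)[of v] by simp
  qed
  have dg: "((\<lambda>z. Ln (p z)) has_field_derivative inverse (p z0) * deriv p z0) (at z0)"
    using DERIV_chain2[OF has_field_derivative_Ln dp] w Ln_exp_cball(2) by auto
  have gz0: "Ln (p z0) = w" using w Ln_exp_cball(1) by simp
  \<comment> \<open>Jack's lemma is applied to \<open>Ln (p z)\<close>, whose derivative is the
    logarithmic derivative of \<open>p\<close>.\<close>
  obtain k where "k \<ge> 1" "z0 * (inverse (p z0) * deriv p z0) = of_real k * Ln (p z0)"
    using Jack[OF hg g0 g_less dg] gz0 nw by auto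
  then have "k \<ge> 1" "z0 * deriv p z0 = of_real k * w * exp w"
    using gz0 w by (auto simp: field_simps)
  with that nz0 nw w(2) show ?thesis by blast
qed

section \<open>Estimates on the unit circle\<close>

text \<open>Taylor's bound for \<open>sin s - s\<close>, multiplied by \<open>s\<close> so that both
  sides are even and the sign of \<open>s\<close> does not matter.\<close>

lemma mult_sin_ge: "s\<^sup>2 - s ^ 4 / 6 \<le> s * sin (s::real)"
proof -
  have "\<bar>sin s - s\<bar> \<le> \<bar>s\<bar> ^ 3 / 6"
    using Maclaurin_sin_bound[of s 3]
    by (simp add: eval_nat_numeral sin_coeff_def fact_numeral)
  then have "\<bar>s\<bar> * \<bar>sin s - s\<bar> \<le> \<bar>s\<bar> * (\<bar>s\<bar> ^ 3 / 6)"
    by (intro mult_left_mono) auto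
  then have "\<bar>s * (sin s - s)\<bar> \<le> s ^ 4 / 6"
    by (simp add: abs_mult eval_nat_numeral)
  then have "- (s ^ 4 / 6) \<le> s * (sin s - s)" by linarith
  then show ?thesis
    by (simp add: algebra_simps power2_eq_square)
qed

text \<open>A point \<open>X\<close> is at distance at least 2 from 2 iff
  \<open>4 * Re X <= (norm X)^2\<close>. For this \<open>X\<close> both sides contain the factor
  \<open>exp c\<close>, and cancelling it leaves the inequality \<open>main\<close>.\<close>

lemma exp_times_outside:
  fixes w :: complex and b :: real
  assumes w: "norm w = 1" and b: "b \<ge> 2"
  shows "norm (exp w * (1 + of_real b * w) - 2) \<ge> 2"
proof -
  define c s where "c = Re w" and "s = Im w"
  have cs: "c\<^sup>2 + s\<^sup>2 = 1"
    using w by (simp add: c_def s_def cmod_def)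
  have c: "\<bar>c\<bar> \<le> 1" and s: "\<bar>s\<bar> \<le> 1"
    using w abs_Re_le_cmod[of w] abs_Im_le_cmod[of w] by (auto simp: c_def s_def)
  have u: "s\<^sup>2 \<le> 1" using cs zero_le_power2[of c] by linarith
  have s4: "s ^ 4 \<le> s\<^sup>2"
    using mult_left_mono[OF u, of "s\<^sup>2"] by (simp add: power4_eq_xxxx power2_eq_square mult_ac)
  then have ssin: "s * sin s \<ge> 5/6 * s\<^sup>2" using mult_sin_ge[of s] by simp
  then have ssin0: "s * sin s \<ge> 0" using zero_le_power2[of s] by linarith
  have main: "4 * (cos s * (1 + b * c) - b * (s * sin s)) \<le> exp c * (1 + b\<^sup>2 + 2 * b * c)"
  proof -
    have n: "1 + b\<^sup>2 + 2 * b * c \<ge> (b - 1)\<^sup>2"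
    proof -
      have "b * (- 1) \<le> b * c" using b c by (intro mult_left_mono) auto
      then show ?thesis by (simp add: power2_eq_square algebra_simps)
    qed
    then have n0: "1 + b\<^sup>2 + 2 * b * c \<ge> 0" by (rule order_trans[OF zero_le_power2])
    define P Q R where "P = cos s * (1 + b * c)" and "Q = b * (s * sin s)"
      and "R = exp c * (1 + b\<^sup>2 + 2 * b * c)"
    have Q0: "Q \<ge> 0" using b ssin0 by (simp add: Q_def)
    have R0: "R \<ge> 0" using n0 by (simp add: R_def)
    \<comment> \<open>Three cases. If \<open>1 + b * c < 0\<close>, then \<open>P <= 0\<close>. If
      \<open>c >= 0\<close>, then \<open>R\<close> alone dominates \<open>4 * P\<close>. Otherwise
      \<open>-1/2 <= c < 0\<close>, so \<open>s^2 >= 3/4\<close>, which yields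
      \<open>P <= 1 <= Q\<close>.\<close>
    have "4 * P - 4 * Q \<le> R"
    proof (cases "1 + b * c \<ge> 0")
      case False
      then have "P \<le> 0"
        unfolding P_def using s cos_ge_zero[of s] pi_gt3 by (intro mult_nonneg_nonpos) auto
      then show ?thesis using Q0 R0 by linarith
    next
      case pos: True
      then have le: "P \<le> 1 + b * c"
        unfolding P_def using mult_right_mono[OF cos_le_one pos, of s] by simp
      show ?thesis
      proof (cases "c \<ge> 0")
        case True
        \<comment> \<open>The difference of the two sides is
          \<open>(b^2 - 3) + c * (b - 1)^2 + 2 * b * c^2\<close>. The factor \<open>1 + c\<close> is
          the tangent bound for \<open>exp c\<close>.\<close>
        have "4 * (1 + b * c) \<le> (1 + c) * (1 + b\<^sup>2 + 2 * b * c)"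
        proof -
          have "b\<^sup>2 \<ge> 4" using power_mono[OF b, of 2] by simp
          moreover have "c * (b - 1)\<^sup>2 \<ge> 0" "b * c\<^sup>2 \<ge> 0" using True b by auto
          ultimately show ?thesis by (simp add: power2_eq_square algebra_simps)
        qed
        also have "\<dots> \<le> R"
          unfolding R_def using n0 by (intro mult_right_mono) auto
        finally show ?thesis using le Q0 unfolding distrib_left by linarith
      next
        case False
        have "2 * (- c) \<le> b * (- c)" using b False by (intro mult_right_mono) auto
        then have "- c \<le> 1/2" using pos by simp
        then have "(- c)\<^sup>2 \<le> (1/2)\<^sup>2" using False by (intro power_mono) auto
        then have "s\<^sup>2 \<ge> 3/4" using cs by (simp add: power2_eq_square)
        then have "s * sin s \<ge> 1/2" using ssin by simp
        then have "Q \<ge> 2 * (1/2)" unfolding Q_def using b by (intro mult_mono) auto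
        moreover have "b * c \<le> 0" using b False by (simp add: mult_nonneg_nonpos)
        ultimately show ?thesis using le R0 by linarith
      qed
    qed
    then show ?thesis by (simp only: P_def Q_def R_def right_diff_distrib)
  qed
  define X where "X = exp w * (1 + of_real b * w)"
  have ReX: "Re X = exp c * (cos s * (1 + b * c) - b * (s * sin s))"
    by (simp add: X_def Re_exp Im_exp c_def s_def algebra_simps)
  have "(norm X)\<^sup>2 = (exp c)\<^sup>2 * (norm (1 + of_real b * w))\<^sup>2"
    by (simp add: X_def norm_mult power_mult_distrib c_def)
  also have "(norm (1 + of_real b * w))\<^sup>2 = 1 + 2 * b * c + b\<^sup>2 * (c\<^sup>2 + s\<^sup>2)"
    unfolding cmod_power2 by (simp add: c_def s_def power2_eq_square algebra_simps)
  finally have nX: "(norm X)\<^sup>2 = exp c * (exp c * (1 + b\<^sup>2 + 2 * b * c))"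
    unfolding cs by (simp add: power2_eq_square algebra_simps)
  have "4 * Re X \<le> (norm X)\<^sup>2"
    using mult_left_mono[OF main, of "exp c"] unfolding ReX nX by (simp add: mult_ac)
  then have "2\<^sup>2 \<le> (norm (X - 2))\<^sup>2"
    unfolding cmod_power2 by (simp add: power2_eq_square algebra_simps)
  then show ?thesis unfolding X_def by (rule power2_le_imp_le) simp
qed

text \<open>On the unit circle \<open>exp w\<close> is within 5/2 of 2, so the triangle inequality
  leaves at least 9/2 - 5/2 = 2.\<close>

lemma exp_plus_outside:
  fixes w :: complex and b :: real
  assumes w: "norm w = 1" and b: "b \<ge> 9/2"
  shows "norm (exp w + of_real b * w - 2) \<ge> 2"
proof -
  define c s where "c = Re w" and "s = Im w"
  have c: "\<bar>c\<bar> \<le> 1" and s: "\<bar>s\<bar> \<le> 1"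
    using w abs_Re_le_cmod[of w] abs_Im_le_cmod[of w] by (auto simp: c_def s_def)
  have "cos s \<ge> cos (pi/3)"
    using s pi_gt3 cos_monotone_0_pi_le[of "\<bar>s\<bar>" "pi/3"] by simp
  then have cos: "cos s \<ge> 1/2" by (simp add: cos_60)
  have "exp c \<le> exp 1" using c by simp
  also have "\<dots> < 272/100" by (rule e_less_272)
  finally have e: "0 < exp c" "exp c < 272/100" by auto
  \<comment> \<open>From 0 < \<open>exp c\<close> < 2.72; the resulting bound 1.72^2 + 3 = 5.9584 is
    below 2.5^2 = 6.25.\<close>
  then have "\<bar>exp c - 1\<bar> \<le> \<bar>172/100\<bar>" by linarith
  then have e': "(exp c - 1)\<^sup>2 \<le> (172/100)\<^sup>2" by (simp only: abs_le_square_iff)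
  have "(norm (exp w - 2))\<^sup>2 = (exp c * cos s - 2)\<^sup>2 + (exp c * sin s)\<^sup>2"
    by (simp add: cmod_power2 Re_exp Im_exp c_def s_def)
  also have "\<dots> = (exp c)\<^sup>2 * ((cos s)\<^sup>2 + (sin s)\<^sup>2) - 4 * (exp c * cos s) + 4"
    by algebra
  also have "\<dots> \<le> (exp c)\<^sup>2 - 2 * exp c + 4"
    using mult_left_mono[OF cos, of "exp c"] e by simp
  also have "\<dots> = (exp c - 1)\<^sup>2 + 3"
    by (simp add: power2_eq_square algebra_simps)
  also note e'
  finally have "(norm (exp w - 2))\<^sup>2 \<le> 2.5\<^sup>2" by (simp add: power2_eq_square)
  then have "norm (exp w - 2) \<le> 2.5" by (rule power2_le_imp_le) simp
  moreover have "norm (of_real b * w) \<le> norm (exp w + of_real b * w - 2) + norm (exp w - 2)"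
    using norm_triangle_ineq4[of "exp w + of_real b * w - 2" "exp w - 2"] by (simp add: algebra_simps)
  ultimately show ?thesis using w b by (simp add: norm_mult)
qed

text \<open>Round lower bounds for the two constants, matching the two estimates above. The common
  numerator equals \<open>2 + sqrt 2 - e * (sqrt 2 - 1)\<close>, so an upper bound for
  \<open>e * (sqrt 2 - 1)\<close> and bounds for \<open>sqrt 2\<close> settle both.\<close>

lemma threshold_a: "2 \<le> (exp 1 + 2 - sqrt 2 * (exp 1 - 1)) / (exp 1 * (sqrt 2 - 1) :: real)"
  and threshold_b: "9/2 \<le> (exp 1 + 2 - sqrt 2 * (exp 1 - 1)) / (sqrt 2 - 1 :: real)"
proof -
  have s: "14/10 < sqrt 2" "sqrt 2 < 1415/1000"
    by (rule real_less_rsqrt real_less_lsqrt; simp add: power2_eq_square)+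
  have es: "exp 1 * (sqrt 2 - 1) \<le> 272/100 * (415/1000::real)"
    using e_less_272 s by (intro mult_mono) auto
  then show "2 \<le> (exp 1 + 2 - sqrt 2 * (exp 1 - 1)) / (exp 1 * (sqrt 2 - 1) :: real)"
    using s by (subst pos_le_divide_eq) (auto simp: algebra_simps)
  have "9/2 * (sqrt 2 - 1) \<le> exp 1 + 2 - sqrt 2 * (exp 1 - 1 :: real)"
    using s es unfolding right_diff_distrib mult.commute[of "sqrt 2" "exp 1"] by linarith
  then show "9/2 \<le> (exp 1 + 2 - sqrt 2 * (exp 1 - 1)) / (sqrt 2 - 1 :: real)"
    using s by (subst pos_le_divide_eq) auto
qed

text \<open>Subtracting 2 from the value at \<open>w\<close> gives
  \<open>(4 * w - 2) / (2 - w)\<close>. After squaring, the claim that its modulus is below 2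
  reduces to \<open>12 * (norm w)^2 < 12\<close>.\<close>

lemma subordinate_imp_in_ball:
  assumes "subordinate F (\<lambda>z. (2 + 2 * z) / (2 - z))" "norm z < 1"
  shows "norm (F z - 2) < 2"
proof -
  obtain w where w: "norm w < 1" "F z = (2 + 2 * w) / (2 - w)"
    using assms unfolding subordinate_def by (metis mem_ball_0)
  have ne: "2 - w \<noteq> 0" using w(1) by auto
  have "(norm w)\<^sup>2 < 1" using w(1) by (simp add: abs_square_less_1)
  then have "(norm (4 * w - 2))\<^sup>2 < (2 * norm (2 - w))\<^sup>2"
    unfolding power_mult_distrib cmod_power2 by (simp add: power2_eq_square algebra_simps)
  then have "norm (4 * w - 2) < 2 * norm (2 - w)"
    by (rule power2_less_imp_less) simp
  then have "norm ((4 * w - 2) / (2 - w)) < 2"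
    using ne by (simp add: norm_divide pos_divide_less_eq)
  moreover have "F z - 2 = (4 * w - 2) / (2 - w)"
    using ne unfolding w(2) by (simp add: field_simps)
  ultimately show ?thesis by simp
qed

theorem theorem3p6:
  fixes p :: "complex \<Rightarrow> complex" and \<beta> :: real
  assumes "p \<in> H1"
  shows "(\<beta> \<ge> (exp 1 + 2 - sqrt 2 * (exp 1 - 1)) / (exp 1 * (sqrt 2 - 1)) \<and>
          subordinate (\<lambda>z. p z + of_real \<beta> * z * deriv p z) (\<lambda>z. (2 + 2 * z) / (2 - z))
          \<longrightarrow> subordinate p exp)
       \<and> (\<beta> \<ge> (exp 1 + 2 - sqrt 2 * (exp 1 - 1)) / (sqrt 2 - 1) \<and>
          subordinate (\<lambda>z. p z + of_real \<beta> * (z * deriv p z / p z)) (\<lambda>z. (2 + 2 * z) / (2 - z))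
          \<longrightarrow> subordinate p exp)"
proof -
  have hol: "p holomorphic_on ball 0 1" using assms by (simp add: H1_def)
  obtain a where a: "a 0 = 1" "\<And>z. z \<in> ball 0 1 \<Longrightarrow> (\<lambda>n. a n * z ^ n) sums p z"
    using assms unfolding H1_def by blast
  have "(\<lambda>n. a n * 0 ^ n) sums p 0" by (rule a(2)) simp
  then have p0: "p 0 = 1" using a(1) powser_sums_zero_iff[of a "p 0"] by simp
  show ?thesis
  proof (intro conjI impI; elim conjE; rule ccontr)
    assume \<beta>: "\<beta> \<ge> (exp 1 + 2 - sqrt 2 * (exp 1 - 1)) / (exp 1 * (sqrt 2 - 1))"
      and sub: "subordinate (\<lambda>z. p z + of_real \<beta> * z * deriv p z) (\<lambda>z. (2 + 2 * z) / (2 - z))"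
      and "\<not> subordinate p exp"
    then obtain z w k where z: "norm z < 1" "norm w = 1" "k \<ge> 1" "p z = exp w"
      "z * deriv p z = of_real k * w * exp w"
      using exp_image_exit_point[OF hol p0] by metis
    have "2 \<le> \<beta>" using threshold_a \<beta> by (rule order_trans)
    \<comment> \<open>The Jack factor \<open>k >= 1\<close> is absorbed into the parameter
      \<open>b = \<beta> * k\<close> of the estimate.\<close>
    then have "2 * 1 \<le> \<beta> * k" using z(3) by (intro mult_mono) auto
    then have "norm (exp w * (1 + of_real (\<beta> * k) * w) - 2) \<ge> 2"
      by (intro exp_times_outside z(2)) simp
    moreover have "p z + of_real \<beta> * z * deriv p z = exp w * (1 + of_real (\<beta> * k) * w)"
      using z(4,5) by (simp add: mult.assoc algebra_simps)
    ultimately show False using subordinate_imp_in_ball[OF sub z(1)] by simp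
  next
    assume \<beta>: "\<beta> \<ge> (exp 1 + 2 - sqrt 2 * (exp 1 - 1)) / (sqrt 2 - 1)"
      and sub: "subordinate (\<lambda>z. p z + of_real \<beta> * (z * deriv p z / p z)) (\<lambda>z. (2 + 2 * z) / (2 - z))"
      and "\<not> subordinate p exp"
    then obtain z w k where z: "norm z < 1" "norm w = 1" "k \<ge> 1" "p z = exp w"
      "z * deriv p z = of_real k * w * exp w"
      using exp_image_exit_point[OF hol p0] by metis
    have "9/2 \<le> \<beta>" using threshold_b \<beta> by (rule order_trans)
    then have "9/2 * 1 \<le> \<beta> * k" using z(3) by (intro mult_mono) auto
    then have "norm (exp w + of_real (\<beta> * k) * w - 2) \<ge> 2"
      by (intro exp_plus_outside z(2)) simp
    \<comment> \<open>Here \<open>p z = exp w\<close> is nonzero, so the quotient is genuine and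
      equals \<open>k * w\<close>.\<close>
    moreover have "p z + of_real \<beta> * (z * deriv p z / p z) = exp w + of_real (\<beta> * k) * w"
      using z(4,5) by simp
    ultimately show False using subordinate_imp_in_ball[OF sub z(1)] by simp
  qed
qed

end
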